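(* Let $$\begin{array}{ccccccccc} \mathbb{C}&\subset^{\varphi_0}&B&\subset^{\varphi_1}&A_1&\subset^{\varphi_2}&A_2&\subset^{\varphi_3}&\cdots \\ &&\cup^{i_0}&&\cup^{i_1}&&\cup^{i_2}&& \\ \mathbb{C}&\subset^{\varphi_0'}&B'&\subset^{\varphi_1'}&A_1'&\subset^{\varphi_2'}&A_2'&\subset^{\varphi_3'}&\cdots \end{array}$$ be a commuting ladder of amalgamated noncommutative probability spaces. Then for any $k<j$ in $\mathbb{N}$, the square of inclusions $$\begin{array}{ccc} A_k&\subset^{E_{k+1,j}}&A_j \\ \cup^{i_k}&&\cup^{i_j} \\ {A_k'}&\subset^{E_{k+1,j}'}&A_j' \end{array}$$ is a commuting square of amalgamated noncommutative probability spaces, i.e. $i_kE_{k+1,j}=E'_{k+1,j}i_j:A_j\to A_k'$.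
   Context: Algebras are unital and complex. A conditional expectation $\varphi:A\to D$ onto a unital subalgebra $D\subset A$ is a linear map with $\varphi(b)=b$ and $\varphi(bxb')=b\varphi(x)b'$ for $b,b'\in D$, $x\in A$. Tower of amalgamated noncommutative probability spaces: unital algebras $A_0=B\subset A_1\subset A_2\subset\cdots$, each a unital subalgebra of the next (common unit), a fixed linear functional $\varphi_0:B\to\mathbb{C}$, and for each $n\ge1$ a conditional expectation $\varphi_n:A_n\to A_{n-1}$. A commuting ladder of amalgamated noncommutative probability spaces consists of two towers $(A_n,\varphi_n)$ (with $A_0=B$) and $(A_n',\varphi_n')$ (with $A_0'=B'$) such that $A_n'\subset A_n$ is a subalgebra with $1_{A_n'}=1_{A_n}$ for all $n\ge0$, together with conditional expectations $i_n:A_n\to A_n'$ ($n\ge0$), such that every square commutes: $i_k\varphi_{k+1}=\varphi_{k+1}'i_{k+1}:A_{k+1}\to A_k'$ for all $k\ge0$. Juxtaposition means composition. For $k<j$, $E_{k+1,j}=\varphi_{k+1}\cdots\varphi_j:A_j\to A_k$ and $E_{k+1,j}'=\varphi_{k+1}'\cdots\varphi_j':A_j'\to A_k'$. *)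

theory Defs
  imports Complex_Main "HOL-Algebra.Module"
begin

definition complex_alg :: "(complex, complex) module" where
  "complex_alg = \<lparr>carrier = UNIV, mult = (*), one = 1, zero = 0, add = (+), smult = (*)\<rparr>"

text \<open>
  The library locale \<open>algebra\<close> assumes commutativity, so unital complex algebras that need not be
  commutative are introduced separately.
\<close>

locale unital_algebra = Module.module complex_alg A + ring A
  for A :: "(complex, 'a) module" (structure) +
  assumes smult_mult_left:
      "\<lbrakk>x \<in> carrier A; y \<in> carrier A\<rbrakk> \<Longrightarrow> (c \<odot> x) \<otimes> y = c \<odot> (x \<otimes> y)"
    and smult_mult_right:
      "\<lbrakk>x \<in> carrier A; y \<in> carrier A\<rbrakk> \<Longrightarrow> x \<otimes> (c \<odot> y) = c \<odot> (x \<otimes> y)"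

locale unital_subalgebra = sub: unital_algebra D + amb: unital_algebra A
  for D A :: "(complex, 'a) module" +
  assumes carrier_subset: "carrier D \<subseteq> carrier A"
    and one_eq: "\<one>\<^bsub>D\<^esub> = \<one>\<^bsub>A\<^esub>"
    and add_eq: "\<lbrakk>x \<in> carrier D; y \<in> carrier D\<rbrakk> \<Longrightarrow> x \<oplus>\<^bsub>D\<^esub> y = x \<oplus>\<^bsub>A\<^esub> y"
    and mult_eq: "\<lbrakk>x \<in> carrier D; y \<in> carrier D\<rbrakk> \<Longrightarrow> x \<otimes>\<^bsub>D\<^esub> y = x \<otimes>\<^bsub>A\<^esub> y"
    and smult_eq: "x \<in> carrier D \<Longrightarrow> c \<odot>\<^bsub>D\<^esub> x = c \<odot>\<^bsub>A\<^esub> x"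

text \<open>
  Maps are total functions on the underlying types; only their values on the carrier of the domain
  algebra matter.
\<close>

definition linear_map ::
    "(complex, 'a) module \<Rightarrow> (complex, 'b) module \<Rightarrow> ('a \<Rightarrow> 'b) \<Rightarrow> bool" where
  "linear_map A D f \<longleftrightarrow>
     f \<in> carrier A \<rightarrow> carrier D \<and>
     (\<forall>x\<in>carrier A. \<forall>y\<in>carrier A. f (x \<oplus>\<^bsub>A\<^esub> y) = f x \<oplus>\<^bsub>D\<^esub> f y) \<and>
     (\<forall>c. \<forall>x\<in>carrier A. f (c \<odot>\<^bsub>A\<^esub> x) = c \<odot>\<^bsub>D\<^esub> f x)"

locale conditional_expectation = unital_subalgebra D A
  for A D :: "(complex, 'a) module" +
  fixes \<phi> :: "'a \<Rightarrow> 'a"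
  assumes linear: "linear_map A D \<phi>"
    and fixes_base: "b \<in> carrier D \<Longrightarrow> \<phi> b = b"
    and bimodule: "\<lbrakk>b \<in> carrier D; b' \<in> carrier D; x \<in> carrier A\<rbrakk> \<Longrightarrow>
      \<phi> (b \<otimes>\<^bsub>A\<^esub> x \<otimes>\<^bsub>A\<^esub> b') = b \<otimes>\<^bsub>D\<^esub> \<phi> x \<otimes>\<^bsub>D\<^esub> b'"

text \<open>
  The bottom algebra \<open>B\<close> is \<open>A 0\<close>.  Its functional to the complex numbers is the separate
  argument \<open>\<phi>0\<close>; for \<open>n \<ge> 1\<close> the expectation from \<open>A n\<close> onto \<open>A (n - 1)\<close> is \<open>\<phi> n\<close>, and
  \<open>\<phi> 0\<close> is not used.
\<close>

locale tower =
  fixes A :: "nat \<Rightarrow> (complex, 'a) module"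
    and \<phi>0 :: "'a \<Rightarrow> complex"
    and \<phi> :: "nat \<Rightarrow> 'a \<Rightarrow> 'a"
  assumes algebra_A: "unital_algebra (A n)"
    and subalgebra_A: "unital_subalgebra (A n) (A (Suc n))"
    and functional: "linear_map (A 0) complex_alg \<phi>0"
    and expectation: "conditional_expectation (A (Suc n)) (A n) (\<phi> (Suc n))"

text \<open>
  The square has \<open>E : A \<rightarrow> D\<close> as its upper and \<open>E' : A' \<rightarrow> D'\<close> as its lower edge, with the vertical
  expectations \<open>i\<^sub>D : D \<rightarrow> D'\<close> and \<open>i\<^sub>A : A \<rightarrow> A'\<close>.
\<close>

definition commuting_square ::
    "(complex, 'a) module \<Rightarrow> (complex, 'a) module \<Rightarrow> (complex, 'a) module \<Rightarrow> (complex, 'a) module \<Rightarrow>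
     ('a \<Rightarrow> 'a) \<Rightarrow> ('a \<Rightarrow> 'a) \<Rightarrow> ('a \<Rightarrow> 'a) \<Rightarrow> ('a \<Rightarrow> 'a) \<Rightarrow> bool" where
  "commuting_square D A D' A' E i\<^sub>D E' i\<^sub>A \<longleftrightarrow>
     conditional_expectation A D E \<and>
     conditional_expectation A' D' E' \<and>
     conditional_expectation D D' i\<^sub>D \<and>
     conditional_expectation A A' i\<^sub>A \<and>
     (\<forall>x\<in>carrier A. (i\<^sub>D \<circ> E) x = (E' \<circ> i\<^sub>A) x)"

locale commuting_ladder =
  upper: tower A \<phi>0 \<phi> + lower: tower A' \<phi>0' \<phi>'
  for A A' :: "nat \<Rightarrow> (complex, 'a) module"
    and \<phi>0 \<phi>0' :: "'a \<Rightarrow> complex"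
    and \<phi> \<phi>' :: "nat \<Rightarrow> 'a \<Rightarrow> 'a" +
  fixes i :: "nat \<Rightarrow> 'a \<Rightarrow> 'a"
  assumes ladder_subalgebra: "unital_subalgebra (A' n) (A n)"
    and ladder_expectation: "conditional_expectation (A n) (A' n) (i n)"
    and ladder_square: "x \<in> carrier (A (Suc k)) \<Longrightarrow>
      (i k \<circ> \<phi> (Suc k)) x = (\<phi>' (Suc k) \<circ> i (Suc k)) x"

text \<open>\<open>composite \<phi> m j\<close> is \<open>\<phi> m \<circ> \<phi> (m + 1) \<circ> \<dots> \<circ> \<phi> j\<close>.\<close>

definition composite :: "(nat \<Rightarrow> 'a \<Rightarrow> 'a) \<Rightarrow> nat \<Rightarrow> nat \<Rightarrow> 'a \<Rightarrow> 'a" where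
  "composite \<phi> m j = foldr (\<circ>) (map \<phi> [m..<Suc j]) id"

end

theory Submission
  imports Defs
begin

text \<open>Commuting squares that share a vertical edge can be pasted: if
  \<open>i\<^sub>C F = F' i\<^sub>D\<close> and \<open>i\<^sub>D E = E' i\<^sub>A\<close>, then
  \<open>i\<^sub>C F E = F' i\<^sub>D E = F' E' i\<^sub>A\<close>. Each cell of the ladder is a
  commuting square by assumption, so induction on \<open>j\<close> attaches one cell at a time at
  the right end. Since the edges of a commuting square must be conditional expectations,
  \<open>commuting_square_paste\<close> also relies on
  \<open>conditional_expectation_comp\<close>.\<close>

lemma unital_subalgebra_trans:
  assumes "unital_subalgebra C D" and "unital_subalgebra D A"
  shows "unital_subalgebra C A"
proof -
  interpret CD: unital_subalgebra C D by fact
  interpret DA: unital_subalgebra D A by fact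
  show ?thesis
  proof
    show "carrier C \<subseteq> carrier A"
      using CD.carrier_subset DA.carrier_subset by blast
    show "\<one>\<^bsub>C\<^esub> = \<one>\<^bsub>A\<^esub>"
      by (simp add: CD.one_eq DA.one_eq)
  next
    fix x y
    assume "x \<in> carrier C" "y \<in> carrier C"
    moreover from this have "x \<in> carrier D" "y \<in> carrier D"
      using CD.carrier_subset by auto
    ultimately show "x \<oplus>\<^bsub>C\<^esub> y = x \<oplus>\<^bsub>A\<^esub> y" "x \<otimes>\<^bsub>C\<^esub> y = x \<otimes>\<^bsub>A\<^esub> y"
      by (simp_all add: CD.add_eq DA.add_eq CD.mult_eq DA.mult_eq)
  next
    fix c x
    assume "x \<in> carrier C"
    moreover from this have "x \<in> carrier D"
      using CD.carrier_subset by auto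
    ultimately show "c \<odot>\<^bsub>C\<^esub> x = c \<odot>\<^bsub>A\<^esub> x"
      by (simp add: CD.smult_eq DA.smult_eq)
  qed
qed

lemma linear_map_comp:
  assumes "linear_map A D f" and "linear_map D C g"
  shows "linear_map A C (g \<circ> f)"
  using assms by (auto simp: linear_map_def Pi_iff)

text \<open>Elements of \<open>C\<close> lie in \<open>D\<close>, so \<open>b\<close> and
  \<open>b'\<close> can be pulled out of \<open>\<phi>\<close> and then out of
  \<open>\<psi>\<close>.\<close>

lemma conditional_expectation_comp:
  assumes "conditional_expectation A D \<phi>" and "conditional_expectation D C \<psi>"
  shows "conditional_expectation A C (\<psi> \<circ> \<phi>)"
proof -
  interpret AD: conditional_expectation A D \<phi> by fact
  interpret DC: conditional_expectation D C \<psi> by fact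
  interpret CA: unital_subalgebra C A
    by (rule unital_subalgebra_trans[OF DC.unital_subalgebra_axioms AD.unital_subalgebra_axioms])
  have CD: "x \<in> carrier D" if "x \<in> carrier C" for x
    using that DC.carrier_subset by auto
  show ?thesis
  proof
    show "linear_map A C (\<psi> \<circ> \<phi>)"
      using AD.linear DC.linear by (rule linear_map_comp)
  next
    fix b
    assume "b \<in> carrier C"
    then show "(\<psi> \<circ> \<phi>) b = b"
      by (simp add: CD AD.fixes_base DC.fixes_base)
  next
    fix b b' x
    assume "b \<in> carrier C" "b' \<in> carrier C" "x \<in> carrier A"
    moreover from this have "\<phi> x \<in> carrier D"
      using AD.linear by (auto simp: linear_map_def)
    ultimately show "(\<psi> \<circ> \<phi>) (b \<otimes>\<^bsub>A\<^esub> x \<otimes>\<^bsub>A\<^esub> b') = b \<otimes>\<^bsub>C\<^esub> (\<psi> \<circ> \<phi>) x \<otimes>\<^bsub>C\<^esub> b'"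
      by (simp add: CD AD.bimodule DC.bimodule)
  qed
qed

lemma commuting_square_paste:
  assumes CD: "commuting_square C D C' D' F i\<^sub>C F' i\<^sub>D"
    and DA: "commuting_square D A D' A' E i\<^sub>D E' i\<^sub>A"
  shows "commuting_square C A C' A' (F \<circ> E) i\<^sub>C (F' \<circ> E') i\<^sub>A"
proof -
  \<comment> \<open>The identity of the left square holds only on the carrier of \<open>D\<close>,
    and it is applied at \<open>E x\<close>.\<close>
  have "E x \<in> carrier D" if "x \<in> carrier A" for x
    using DA that
    by (auto simp: commuting_square_def linear_map_def dest!: conditional_expectation.linear)
  then show ?thesis
    using assms by (auto simp: commuting_square_def intro: conditional_expectation_comp)
qed

text \<open>Splitting off the last factor of a composite leaves that factor as the seed of the fold;
  this moves it outside.\<close>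

lemma foldr_comp_eq: "foldr (\<circ>) fs g = foldr (\<circ>) fs id \<circ> g"
  by (induction fs) (simp_all add: comp_assoc)

lemma composite_single: "composite \<phi> m m = \<phi> m"
  by (simp add: composite_def)

lemma composite_Suc:
  assumes "m \<le> Suc j"
  shows "composite \<phi> m (Suc j) = composite \<phi> m j \<circ> \<phi> (Suc j)"
proof -
  \<comment> \<open>The case \<open>m = Suc j\<close> is allowed: the shorter list is then empty and
    its composite is \<open>id\<close>.\<close>
  have "[m..<Suc (Suc j)] = [m..<Suc j] @ [Suc j]"
    using assms by simp
  then show ?thesis
    unfolding composite_def by (simp del: upt_Suc flip: foldr_comp_eq)
qed

lemma (in commuting_ladder) commuting_square_step:
  "commuting_square (A k) (A (Suc k)) (A' k) (A' (Suc k)) (\<phi> (Suc k)) (i k) (\<phi>' (Suc k)) (i (Suc k))"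
  unfolding commuting_square_def
  by (intro conjI ballI upper.expectation lower.expectation ladder_expectation ladder_square)

theorem proposition4p1:
  fixes A A' :: "nat \<Rightarrow> (complex, 'a) module"
    and \<phi>0 \<phi>0' :: "'a \<Rightarrow> complex"
    and \<phi> \<phi>' i :: "nat \<Rightarrow> 'a \<Rightarrow> 'a"
    and k j :: nat
  assumes "commuting_ladder A A' \<phi>0 \<phi>0' \<phi> \<phi>' i"
    and "k < j"
  shows "commuting_square (A k) (A j) (A' k) (A' j)
           (composite \<phi> (k + 1) j) (i k) (composite \<phi>' (k + 1) j) (i j)"
proof -
  interpret commuting_ladder A A' \<phi>0 \<phi>0' \<phi> \<phi>' i by fact
  from \<open>k < j\<close> have "Suc k \<le> j"
    by simp
  then show ?thesis
  \<comment> \<open>The induction starts at \<open>Suc k\<close>, where the composite is a single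
    expectation and the square is one cell of the ladder.\<close>
  proof (induction j rule: dec_induct)
    case base
    show ?case
      using commuting_square_step by (simp add: composite_single)
  next
    case (step n)
    show ?case
      \<comment> \<open>The cell between levels \<open>n\<close> and \<open>Suc n\<close> is pasted
        along \<open>i n\<close>; \<open>Suc k \<le> n\<close> lets \<open>composite_Suc\<close>
        absorb its horizontal edges.\<close>
      using commuting_square_paste[OF step.IH commuting_square_step] step.hyps
      by (simp add: composite_Suc comp_def)
  qed
qed

end
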